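(* Let $A=(A,S,g)$ be a pivotal algebra over $k$ and let $V$ be a finite-dimensional absolutely simple left $A$-module. Then $\nu(V)\in\{0,\pm1\}$. Moreover, the following are equivalent: (1) $\nu(V)\neq0$. (2) $V$ is isomorphic to $V^\vee$ as a left $A$-module. (3) There exists a non-degenerate bilinear form $b:V\times V\to k$ satisfying $b(av,w)=b(v,S(a)w)$ for all $a\in A$ and $v,w\in V$. If one of the equivalent statements (1), (2), (3) holds, then a non-degenerate bilinear form $b:V\times V\to k$ satisfying $b(av,w)=b(v,S(a)w)$ for all $a\in A$ and $v,w\in V$ is unique up to scalar multiples and satisfies $b(w,gv)=\nu(V)\cdot b(v,w)$ for all $v,w\in V$.
   Context: $k$ is a field of characteristic not two; algebras are unital associative $k$-algebras. A pivotal algebra is a triple $(A,S,g)$ consisting of an algebra $A$, an anti-algebra map $S:A\to A$ and an invertible element $g\in A$ such that $S(g)=g^{-1}$ and $S^2(a)=gag^{-1}$ for all $a\in A$. For a finite-dimensional left $A$-module $V$, the dual space $V^\vee=\mathrm{Hom}_k(V,k)$ is a left $A$-module by $\langle af,v\rangle=\langle f,S(a)v\rangle$, and $j_V:V\to V^{\vee\vee}$, $\langle j_V(v),f\rangle=\langle f,gv\rangle$, is an isomorphism of left $A$-modules. The Frobenius--Schur indicator $\nu(V)\in k$ is the trace of the $k$-linear map $\mathrm{Hom}_A(V,V^\vee)\to\mathrm{Hom}_A(V,V^\vee)$, $f\mapsto f^\vee\circ j_V$, where $f^\vee:V^{\vee\vee}\to V^\vee$ is the transpose of $f$. A simple module $V$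 is absolutely simple if $\mathrm{End}_A(V)\cong k$. *)

theory Defs
  imports Complex_Main "HOL-Library.Function_Algebras"
begin

(* The classes ring and monoid_mult together are ring_1 without the axiom 0 ~= 1,
   so that the zero algebra is not excluded. *)
locale unital_algebra = vector_space scaleA
  for scaleA :: "'k::field \<Rightarrow> 'a::{ring, monoid_mult} \<Rightarrow> 'a" +
  assumes scale_mult_left: "scaleA c a * b = scaleA c (a * b)"
    and scale_mult_right: "a * scaleA c b = scaleA c (a * b)"

locale pivotal_algebra = unital_algebra scaleA
  for scaleA :: "'k::field \<Rightarrow> 'a::{ring, monoid_mult} \<Rightarrow> 'a" +
  fixes S :: "'a \<Rightarrow> 'a" and g :: 'a
  assumes S_linear: "Vector_Spaces.linear scaleA scaleA S"
    and S_one: "S 1 = 1"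
    and S_mult: "S (a * b) = S b * S a"
    and pivot: "\<exists>g'. g * g' = 1 \<and> g' * g = 1 \<and> S g = g' \<and> (\<forall>a. S (S a) = g * a * g')"

(* Modules are carried by subspaces of an ambient vector space, because the dual module
   of V is not a type of its own. *)
record ('k, 'a, 'v) lmodule =
  carrier :: "'v set"
  smult :: "'k \<Rightarrow> 'v \<Rightarrow> 'v"
  act :: "'a \<Rightarrow> 'v \<Rightarrow> 'v"

locale left_module =
  A: unital_algebra scaleA + V: vector_space "smult M"
  for scaleA :: "'k::field \<Rightarrow> 'a::{ring, monoid_mult} \<Rightarrow> 'a"
    and M :: "('k, 'a, 'v::ab_group_add) lmodule" +
  assumes subspace_carrier: "module.subspace (smult M) (carrier M)"
    and act_closed: "v \<in> carrier M \<Longrightarrow> act M a v \<in> carrier M"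
    and act_add_right: "v \<in> carrier M \<Longrightarrow> w \<in> carrier M \<Longrightarrow> act M a (v + w) = act M a v + act M a w"
    and act_smult_right: "v \<in> carrier M \<Longrightarrow> act M a (smult M c v) = smult M c (act M a v)"
    and act_add_left: "v \<in> carrier M \<Longrightarrow> act M (a + b) v = act M a v + act M b v"
    and act_scale_left: "v \<in> carrier M \<Longrightarrow> act M (scaleA c a) v = smult M c (act M a v)"
    and act_one: "v \<in> carrier M \<Longrightarrow> act M 1 v = v"
    and act_mult: "v \<in> carrier M \<Longrightarrow> act M (a * b) v = act M a (act M b v)"

definition finite_dim :: "('k::field, 'a, 'v::ab_group_add) lmodule \<Rightarrow> bool"
  where "finite_dim M \<longleftrightarrow> (\<exists>B. finite B \<and> module.span (smult M) B = carrier M)"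

definition lsubmodule :: "'v::ab_group_add set \<Rightarrow> ('k::field, 'a, 'v) lmodule \<Rightarrow> bool"
  where "lsubmodule N M \<longleftrightarrow> N \<subseteq> carrier M \<and> module.subspace (smult M) N \<and>
    (\<forall>a. \<forall>v\<in>N. act M a v \<in> N)"

definition simple_module :: "('k::field, 'a, 'v::ab_group_add) lmodule \<Rightarrow> bool"
  where "simple_module M \<longleftrightarrow> carrier M \<noteq> {0} \<and>
    (\<forall>N. lsubmodule N M \<longrightarrow> N = {0} \<or> N = carrier M)"

definition fun_smult :: "('k \<Rightarrow> 'w \<Rightarrow> 'w) \<Rightarrow> 'k \<Rightarrow> ('v \<Rightarrow> 'w) \<Rightarrow> 'v \<Rightarrow> 'w"
  where "fun_smult s c f = (\<lambda>v. s c (f v))"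

definition linear_on :: "'v::ab_group_add set \<Rightarrow> ('k \<Rightarrow> 'v \<Rightarrow> 'v) \<Rightarrow>
    ('k \<Rightarrow> 'w::ab_group_add \<Rightarrow> 'w) \<Rightarrow> ('v \<Rightarrow> 'w) \<Rightarrow> bool"
  where "linear_on V s t f \<longleftrightarrow> (\<forall>v\<in>V. \<forall>w\<in>V. f (v + w) = f v + f w) \<and>
    (\<forall>c. \<forall>v\<in>V. f (s c v) = t c (f v))"

definition restrict0 :: "'v set \<Rightarrow> ('v \<Rightarrow> 'w::zero) \<Rightarrow> 'v \<Rightarrow> 'w"
  where "restrict0 V f = (\<lambda>v. if v \<in> V then f v else 0)"

(* Maps defined on a carrier are represented by functions that vanish outside of it. The
   representation is unique, and compatible with pointwise addition and scaling. *)
definition dual_space :: "('k::field, 'a, 'v::ab_group_add) lmodule \<Rightarrow> ('v \<Rightarrow> 'k) set"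
  where "dual_space M = {f. linear_on (carrier M) (smult M) (*) f \<and> (\<forall>v. v \<notin> carrier M \<longrightarrow> f v = 0)}"

definition lmodule_hom :: "('k::field, 'a, 'v::ab_group_add) lmodule \<Rightarrow>
    ('k, 'a, 'w::ab_group_add) lmodule \<Rightarrow> ('v \<Rightarrow> 'w) set"
  where "lmodule_hom M N = {f. f ` carrier M \<subseteq> carrier N \<and>
    linear_on (carrier M) (smult M) (smult N) f \<and>
    (\<forall>a. \<forall>v\<in>carrier M. f (act M a v) = act N a (f v)) \<and>
    (\<forall>v. v \<notin> carrier M \<longrightarrow> f v = 0)}"

definition lmodule_iso :: "('k::field, 'a, 'v::ab_group_add) lmodule \<Rightarrow>
    ('k, 'a, 'w::ab_group_add) lmodule \<Rightarrow> bool"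
  where "lmodule_iso M N \<longleftrightarrow> (\<exists>f\<in>lmodule_hom M N. bij_betw f (carrier M) (carrier N))"

(* The map \<phi> below is an isomorphism of k-algebras from k onto the endomorphism algebra. *)
definition absolutely_simple :: "('k::field, 'a, 'v::ab_group_add) lmodule \<Rightarrow> bool"
  where "absolutely_simple M \<longleftrightarrow> simple_module M \<and>
    (\<exists>\<phi> :: 'k \<Rightarrow> 'v \<Rightarrow> 'v. bij_betw \<phi> UNIV (lmodule_hom M M) \<and>
      (\<forall>x y. \<phi> (x + y) = \<phi> x + \<phi> y) \<and> (\<forall>c x. \<phi> (c * x) = fun_smult (smult M) c (\<phi> x)) \<and>
      (\<forall>x y. \<phi> (x * y) = \<phi> x \<circ> \<phi> y) \<and> \<phi> 1 = restrict0 (carrier M) id)"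

definition dual_module :: "('a \<Rightarrow> 'a) \<Rightarrow> ('k::field, 'a, 'v::ab_group_add) lmodule \<Rightarrow>
    ('k, 'a, 'v \<Rightarrow> 'k) lmodule"
  where "dual_module S M = \<lparr>carrier = dual_space M, smult = fun_smult (*),
    act = (\<lambda>a f. restrict0 (carrier M) (\<lambda>v. f (act M (S a) v)))\<rparr>"

definition pivot_map :: "'a \<Rightarrow> ('k::field, 'a, 'v::ab_group_add) lmodule \<Rightarrow> 'v \<Rightarrow> ('v \<Rightarrow> 'k) \<Rightarrow> 'k"
  where "pivot_map g M = restrict0 (carrier M) (\<lambda>v. restrict0 (dual_space M) (\<lambda>f. f (act M g v)))"

definition transpose_map :: "('k::field, 'a, 'v::ab_group_add) lmodule \<Rightarrow>
    ('k, 'a, 'w::ab_group_add) lmodule \<Rightarrow> ('v \<Rightarrow> 'w) \<Rightarrow> ('w \<Rightarrow> 'k) \<Rightarrow> 'v \<Rightarrow> 'k"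
  where "transpose_map M N f =
    restrict0 (dual_space N) (\<lambda>\<xi>. restrict0 (carrier M) (\<lambda>v. \<xi> (f v)))"

(* Trace of a linear endomorphism T of a finite-dimensional subspace W: the sum of the
   diagonal matrix entries of T in a basis of W. The choice of the basis is immaterial. *)
definition trace_on :: "('k::field \<Rightarrow> 'v::ab_group_add \<Rightarrow> 'v) \<Rightarrow> 'v set \<Rightarrow> ('v \<Rightarrow> 'v) \<Rightarrow> 'k"
  where "trace_on s W T =
    (let B = SOME B. \<not> module.dependent s B \<and> module.span s B = W
     in \<Sum>b\<in>B. module.representation s B (T b) b)"

definition fs_indicator :: "('a \<Rightarrow> 'a) \<Rightarrow> 'a \<Rightarrow> ('k::field, 'a, 'v::ab_group_add) lmodule \<Rightarrow> 'k"
  where "fs_indicator S g V =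
    trace_on (fun_smult (fun_smult (*))) (lmodule_hom V (dual_module S V))
      (\<lambda>f. transpose_map V (dual_module S V) f \<circ> pivot_map g V)"

definition bilinear_form :: "('k::field, 'a, 'v::ab_group_add) lmodule \<Rightarrow> ('v \<Rightarrow> 'v \<Rightarrow> 'k) \<Rightarrow> bool"
  where "bilinear_form V b \<longleftrightarrow>
    (\<forall>w\<in>carrier V. linear_on (carrier V) (smult V) (*) (\<lambda>v. b v w)) \<and>
    (\<forall>v\<in>carrier V. linear_on (carrier V) (smult V) (*) (\<lambda>w. b v w))"

definition nondegenerate :: "('k::field, 'a, 'v::ab_group_add) lmodule \<Rightarrow> ('v \<Rightarrow> 'v \<Rightarrow> 'k) \<Rightarrow> bool"
  where "nondegenerate V b \<longleftrightarrow>
    (\<forall>v\<in>carrier V. (\<forall>w\<in>carrier V. b v w = 0) \<longrightarrow> v = 0) \<and>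
    (\<forall>w\<in>carrier V. (\<forall>v\<in>carrier V. b v w = 0) \<longrightarrow> w = 0)"

definition nondeg_adjoint_form :: "('a \<Rightarrow> 'a) \<Rightarrow> ('k::field, 'a, 'v::ab_group_add) lmodule \<Rightarrow>
    ('v \<Rightarrow> 'v \<Rightarrow> 'k) \<Rightarrow> bool"
  where "nondeg_adjoint_form S V b \<longleftrightarrow> bilinear_form V b \<and> nondegenerate V b \<and>
    (\<forall>a. \<forall>v\<in>carrier V. \<forall>w\<in>carrier V. b (act V a v) w = b v (act V (S a) w))"

end

theory Submission
  imports Defs
begin

text \<open>A homomorphism from \<open>V\<close> to its dual is the same as a bilinear form \<open>b\<close> with
  \<open>b(av, w) = b(v, S(a)w)\<close>, and the operator \<open>T\<close> whose trace is the indicator sends \<open>b\<close> to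
  \<open>(v, w) \<mapsto> b(w, gv)\<close>. Since \<open>S(g) = g\<^sup>-\<^sup>1\<close>, \<open>T\<close> is an involution. By Schur's lemma
  every non-zero form of this kind is non-degenerate, hence gives an isomorphism onto the dual, so
  the space of such forms has dimension at most one. Thus \<open>T\<close> is \<open>\<plusminus>1\<close> on it, and the trace is this
  sign, or \<open>0\<close> if there is no non-zero form.\<close>

section \<open>Linear algebra for maps that are linear only on a subspace, and traces of
  scalars\<close>

lemma sum_fun_apply: "(\<Sum>i\<in>I. F i) x = (\<Sum>i\<in>I. F i x)"
  by (induction I rule: infinite_finite_induct) simp_all

lemma vector_space_fun_smult:
  assumes "vector_space s"
  shows "vector_space (fun_smult s :: 'k::field \<Rightarrow> ('v \<Rightarrow> 'w::ab_group_add) \<Rightarrow> 'v \<Rightarrow> 'w)"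
proof -
  interpret vector_space s by fact
  show ?thesis
    by unfold_locales (auto simp: fun_smult_def fun_eq_iff scale_right_distrib scale_left_distrib)
qed

lemma vector_space_times: "vector_space ((*) :: 'k::field \<Rightarrow> 'k \<Rightarrow> 'k)"
  by unfold_locales (auto simp: algebra_simps)

context vector_space
begin

text \<open>Gives access to the theory of \<open>Vector_Spaces.linear\<close> for maps known only on
  \<open>U\<close>: the values of \<open>f\<close> on a basis of \<open>U\<close> determine the
  extension, and agreement spreads over the span by induction.\<close>

lemma linear_on_extend:
  assumes t: "vector_space t" and U: "subspace U" and f: "linear_on U scale t f"
  obtains h where "Vector_Spaces.linear scale t h" "\<And>v. v \<in> U \<Longrightarrow> h v = f v"
proof -
  interpret t: vector_space t by fact
  interpret p: vector_space_pair scale t ..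
  obtain B where B: "B \<subseteq> U" "independent B" "U \<subseteq> span B"
    by (rule maximal_independent_subset)
  obtain h where h: "Vector_Spaces.linear scale t h" "\<forall>x\<in>B. h x = f x"
    using p.linear_independent_extend[OF B(2)] by blast
  interpret h: Vector_Spaces.linear scale t h by fact
  have f0: "f 0 = 0"
    using f subspace_0[OF U] unfolding linear_on_def by (metis add_cancel_right_left)
  have "v \<in> U \<and> h v = f v" if "v \<in> span B" for v
    using that
  proof (induction rule: span_induct_alt)
    case base
    show ?case using f0 subspace_0[OF U] h.zero by simp
  next
    case (step c x y)
    have x: "x \<in> U" "h x = f x" using step B(1) h(2) by auto
    have cx: "scale c x \<in> U" using subspace_scale[OF U x(1)] .
    have "f (scale c x + y) = t c (f x) + f y"
      using f cx step x(1) unfolding linear_on_def by metis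
    then show ?case
      using step x cx subspace_add[OF U cx] by (simp add: h.add h.scale)
  qed
  then show ?thesis using that h(1) B(3) by blast
qed

text \<open>Dimension count: the image of \<open>B\<close> is independent inside the span of
  \<open>C\<close> and has at least \<open>card C\<close> elements, so it already spans.\<close>

lemma inj_on_linear_on_image_eq_span:
  assumes t: "vector_space t" and f: "linear_on (span B) scale t f"
    and B: "independent B" and inj: "inj_on f (span B)"
    and C: "finite C" "card C \<le> card B" and sub: "f ` span B \<subseteq> module.span t C"
  shows "f ` span B = module.span t C"
proof -
  interpret t: vector_space t by fact
  interpret p: vector_space_pair scale t ..
  obtain h where h: "Vector_Spaces.linear scale t h" and hf: "\<And>v. v \<in> span B \<Longrightarrow> h v = f v"
    using linear_on_extend[OF t subspace_span f] by blast
  have img: "h ` span B = f ` span B" using hf by (auto simp: image_iff)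
  have hinj: "inj_on h (span B)" using inj hf by (metis inj_on_cong)
  have ind: "t.independent (h ` B)"
    using p.linear_independent_injective_image[OF h B hinj] .
  have hs: "t.span (h ` B) = h ` span B" by (rule p.linear_span_image[OF h])
  have hBC: "h ` B \<subseteq> t.span C"
    using t.span_superset[of "h ` B"] hs img sub by blast
  have card: "card (h ` B) = card B"
    using hinj span_superset[of B] by (meson card_image inj_on_subset)
  have "card (h ` B) \<le> card C"
    using t.independent_span_bound[OF C(1) ind hBC] by simp
  then have eq: "card (h ` B) = card C" using card C(2) by simp
  have "C \<subseteq> t.span (h ` B)"
  proof
    fix x assume "x \<in> C"
    show "x \<in> t.span (h ` B)"
    proof (rule ccontr)
      assume x: "x \<notin> t.span (h ` B)"
      then have ins: "t.independent (insert x (h ` B))" using ind by (rule t.independent_insertI)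
      have "insert x (h ` B) \<subseteq> t.span C" using hBC t.span_base[OF \<open>x \<in> C\<close>] by simp
      then have "finite (insert x (h ` B)) \<and> card (insert x (h ` B)) \<le> card C"
        by (rule t.independent_span_bound[OF C(1) ins])
      moreover have "x \<notin> h ` B" using x t.span_base[of x "h ` B"] by metis
      ultimately show False using eq by auto
    qed
  qed
  then have "t.span C \<subseteq> f ` span B"
    using t.span_minimal[OF _ t.subspace_span] hs img by metis
  then show ?thesis using sub by blast
qed

text \<open>\<open>trace_on\<close> uses an unspecified basis. For a scalar operator every diagonal
  entry is \<open>c\<close> in any basis, and all bases have the same size.\<close>

lemma trace_on_scalar:
  assumes C: "independent C" "finite C"
    and T: "\<And>x. x \<in> span C \<Longrightarrow> T x = scale c x"
  shows "trace_on scale (span C) T = of_nat (card C) * c"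
proof -
  define B where "B = (SOME B. independent B \<and> span B = span C)"
  have B: "independent B" "span B = span C"
    using someI_ex[of "\<lambda>B. independent B \<and> span B = span C"] C(1) unfolding B_def by blast+
  have "card B = card C"
    using bij_if_span_eq_span_bases[OF B(1) C(1) B(2)] bij_betw_same_card by blast
  have "representation B (T b) b = c" if "b \<in> B" for b
  proof -
    have "b \<in> span B" using that by (rule span_base)
    then show ?thesis
      using T[of b] B that by (simp add: representation_scale representation_basis)
  qed
  then show ?thesis
    unfolding trace_on_def B_def[symmetric] Let_def by (simp add: \<open>card B = card C\<close>)
qed

end

section \<open>Finite-dimensional duals and Schur's lemma\<close>

context left_module
begin

abbreviation "C \<equiv> carrier M"

lemma carrier_0: "0 \<in> C"
  using V.subspace_0[OF subspace_carrier] .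

lemma carrier_add: "v \<in> C \<Longrightarrow> w \<in> C \<Longrightarrow> v + w \<in> C"
  using V.subspace_add[OF subspace_carrier] .

lemma carrier_smult: "v \<in> C \<Longrightarrow> smult M c v \<in> C"
  using V.subspace_scale[OF subspace_carrier] .

text \<open>The coordinate functionals of a basis span the dual, so its dimension is at most that of
  \<open>C\<close>, and an injective linear map into it is onto.\<close>

lemma linear_on_dual_inj_imp_surj:
  assumes fin: "finite_dim M" and f: "linear_on C (smult M) (fun_smult (*)) f"
    and img: "f ` C \<subseteq> dual_space M" and inj: "inj_on f C"
  shows "f ` C = dual_space M"
proof -
  interpret D: vector_space "fun_smult (*) :: 'k \<Rightarrow> ('v \<Rightarrow> 'k) \<Rightarrow> 'v \<Rightarrow> 'k"
    by (rule vector_space_fun_smult[OF vector_space_times])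
  obtain B0 where B0: "finite B0" "V.span B0 = C" using fin unfolding finite_dim_def by blast
  obtain B where B: "B \<subseteq> C" "V.independent B" "C \<subseteq> V.span B"
    by (rule V.maximal_independent_subset)
  have sB: "V.span B = C" using B V.span_minimal[OF _ subspace_carrier] by blast
  have finB: "finite B" using V.independent_span_bound[OF B0(1) B(2)] B(1) B0(2) by blast
  \<comment> \<open>The coordinate functional of \<open>b\<close>, cut off outside \<open>C\<close>
    as membership in \<open>dual_space M\<close> demands.\<close>
  define e where "e b = restrict0 C (\<lambda>v. V.representation B v b)" for b
  have expand: "\<xi> = (\<Sum>b\<in>B. fun_smult (*) (\<xi> b) (e b))" if \<xi>: "\<xi> \<in> dual_space M" for \<xi>
  proof
    fix v
    show "\<xi> v = (\<Sum>b\<in>B. fun_smult (*) (\<xi> b) (e b)) v"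
    proof (cases "v \<in> C")
      case False
      then show ?thesis using \<xi> by (simp add: dual_space_def sum_fun_apply fun_smult_def e_def restrict0_def)
    next
      case True
      have lin: "linear_on C (smult M) (*) \<xi>" using \<xi> by (simp add: dual_space_def)
      obtain h where h: "Vector_Spaces.linear (smult M) (*) h" "\<And>v. v \<in> C \<Longrightarrow> h v = \<xi> v"
        using V.linear_on_extend[OF vector_space_times subspace_carrier lin] by blast
      interpret h: Vector_Spaces.linear "smult M" "(*)" h by fact
      have "h v = h (\<Sum>b\<in>B. smult M (V.representation B v b) b)"
        using V.sum_representation_eq[OF B(2) _ finB order_refl, of v] True sB by simp
      also have "\<dots> = (\<Sum>b\<in>B. V.representation B v b * h b)" by (simp add: h.sum h.scale)
      also have "\<dots> = (\<Sum>b\<in>B. \<xi> b * e b v)"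
        using True B(1) h(2) by (intro sum.cong) (auto simp: e_def restrict0_def)
      finally show ?thesis using h(2)[OF True] by (simp add: sum_fun_apply fun_smult_def)
    qed
  qed
  have e_dual: "e b \<in> dual_space M" for b
    using V.representation_add[OF B(2)] V.representation_scale[OF B(2)] sB
    by (auto simp: dual_space_def linear_on_def e_def restrict0_def carrier_add carrier_smult)
  have sub: "D.subspace (dual_space M)"
    by (rule D.subspaceI)
      (auto simp: dual_space_def linear_on_def fun_smult_def algebra_simps)
  have "D.span (e ` B) = dual_space M"
  proof
    show "D.span (e ` B) \<subseteq> dual_space M" using e_dual by (intro D.span_minimal sub) auto
    show "dual_space M \<subseteq> D.span (e ` B)"
    proof
      fix \<xi> assume "\<xi> \<in> dual_space M"
      then have "\<xi> = (\<Sum>b\<in>B. fun_smult (*) (\<xi> b) (e b))" by (rule expand)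
      also have "\<dots> \<in> D.span (e ` B)" by (intro D.span_sum D.span_scale D.span_base) auto
      finally show "\<xi> \<in> D.span (e ` B)" .
    qed
  qed
  then show ?thesis
    using V.inj_on_linear_on_image_eq_span[OF D.vector_space_axioms _ B(2), of f "e ` B"]
      f inj img finB sB card_image_le[OF finB, of e] by simp
qed

text \<open>Simplicity in predicate form, applied to the submodule of vectors satisfying
  \<open>P\<close>; it serves for the left and the right radical of a form alike.\<close>

lemma simple_submodule_cases:
  assumes "simple_module M" "P 0"
    and "\<And>v w. v \<in> C \<Longrightarrow> w \<in> C \<Longrightarrow> P v \<Longrightarrow> P w \<Longrightarrow> P (v + w)"
    and "\<And>c v. v \<in> C \<Longrightarrow> P v \<Longrightarrow> P (smult M c v)"
    and "\<And>a v. v \<in> C \<Longrightarrow> P v \<Longrightarrow> P (act M a v)"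
  shows "(\<forall>v\<in>C. P v \<longrightarrow> v = 0) \<or> (\<forall>v\<in>C. P v)"
proof -
  have "lsubmodule {v \<in> C. P v} M"
    unfolding lsubmodule_def
    using assms carrier_0 carrier_add carrier_smult act_closed by (auto intro!: V.subspaceI)
  then have "{v \<in> C. P v} = {0} \<or> {v \<in> C. P v} = C"
    using assms(1) unfolding simple_module_def by blast
  then show ?thesis by blast
qed

text \<open>The isomorphism \<open>\<phi>\<close> is \<open>k\<close>-linear and sends 1 to the
  identity, so \<open>\<phi> c\<close> is \<open>c\<close> times the identity, and
  \<open>\<phi>\<close> is onto.\<close>

lemma absolutely_simple_endomorphism:
  assumes "absolutely_simple M" "h \<in> lmodule_hom M M"
  obtains c where "\<And>v. v \<in> C \<Longrightarrow> h v = smult M c v"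
proof -
  obtain \<phi> :: "'k \<Rightarrow> 'v \<Rightarrow> 'v" where \<phi>: "bij_betw \<phi> UNIV (lmodule_hom M M)"
      "\<And>c x. \<phi> (c * x) = fun_smult (smult M) c (\<phi> x)" "\<phi> 1 = restrict0 C id"
    using assms(1) unfolding absolutely_simple_def by blast
  obtain c where c: "h = \<phi> c" using \<phi>(1) assms(2) by (metis bij_betw_imp_surj_on imageE)
  have "h v = smult M c v" if "v \<in> C" for v
    using \<phi>(2)[of c 1] \<phi>(3) that by (simp add: c fun_smult_def restrict0_def)
  then show ?thesis using that by blast
qed

end

section \<open>Adjoint forms as homomorphisms into the dual\<close>

definition adjoint_form where
  "adjoint_form S M b \<longleftrightarrow> bilinear_form M b \<and>
    (\<forall>a. \<forall>v\<in>carrier M. \<forall>w\<in>carrier M. b (act M a v) w = b v (act M (S a) w))"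

text \<open>A form may take any values off the carrier, whereas homomorphisms into the dual vanish
  there in both arguments; truncation passes from the former to the latter.\<close>

definition restrict_form where
  "restrict_form M b = restrict0 (carrier M) (\<lambda>v. restrict0 (carrier M) (b v))"

lemma restrict_form_apply:
  "v \<in> carrier M \<Longrightarrow> w \<in> carrier M \<Longrightarrow> restrict_form M b v w = b v w"
  by (simp add: restrict_form_def restrict0_def)

lemma nondeg_adjoint_form_iff:
  "nondeg_adjoint_form S M b \<longleftrightarrow> adjoint_form S M b \<and> nondegenerate M b"
  by (auto simp: nondeg_adjoint_form_def adjoint_form_def)

locale pivotal_module = P: pivotal_algebra scaleA S g + left_module scaleA M
  for scaleA :: "'k::field \<Rightarrow> 'a::{ring, monoid_mult} \<Rightarrow> 'a"
    and S :: "'a \<Rightarrow> 'a" and g :: 'a and M :: "('k, 'a, 'v::ab_group_add) lmodule"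
begin

abbreviation "Hom \<equiv> lmodule_hom M (dual_module S M)"

text \<open>Homomorphisms into the dual are curried forms: equivariance for the dual action is
  adjointness, and the vanishing in each argument comes from the encodings of
  \<open>lmodule_hom\<close> and \<open>dual_space\<close>.\<close>

lemma Hom_iff:
  "f \<in> Hom \<longleftrightarrow> adjoint_form S M f \<and> (\<forall>v w. v \<notin> C \<or> w \<notin> C \<longrightarrow> f v w = 0)"
proof
  assume f: "f \<in> Hom"
  then have img: "f v \<in> dual_space M" if "v \<in> C" for v
    using that by (auto simp: lmodule_hom_def dual_module_def)
  have "f v w = 0" if "v \<notin> C \<or> w \<notin> C" for v w
    using f img[of v] that by (cases "v \<in> C") (auto simp: lmodule_hom_def dual_space_def)
  moreover have "adjoint_form S M f"
    using f img
    by (auto simp: lmodule_hom_def dual_module_def adjoint_form_def bilinear_form_def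
        linear_on_def fun_smult_def dual_space_def restrict0_def)
  ultimately show "adjoint_form S M f \<and> (\<forall>v w. v \<notin> C \<or> w \<notin> C \<longrightarrow> f v w = 0)"
    by blast
next
  assume f: "adjoint_form S M f \<and> (\<forall>v w. v \<notin> C \<or> w \<notin> C \<longrightarrow> f v w = 0)"
  then have "f (v + w) = f v + f w" if "v \<in> C" "w \<in> C" for v w
  proof -
    have "f (v + w) x = f v x + f w x" for x
      using f that by (cases "x \<in> C") (auto simp: adjoint_form_def bilinear_form_def linear_on_def)
    then show ?thesis by (simp add: fun_eq_iff)
  qed
  moreover have "f (smult M c v) = fun_smult (*) c (f v)" if "v \<in> C" for c v
  proof -
    have "f (smult M c v) x = c * f v x" for x
      using f that by (cases "x \<in> C") (auto simp: adjoint_form_def bilinear_form_def linear_on_def)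
    then show ?thesis by (simp add: fun_eq_iff fun_smult_def)
  qed
  moreover have "f (act M a v) = restrict0 C (\<lambda>w. f v (act M (S a) w))" if "v \<in> C" for a v
    using f that by (auto simp: fun_eq_iff adjoint_form_def restrict0_def)
  moreover have "f v \<in> dual_space M" if "v \<in> C" for v
    using f that by (auto simp: dual_space_def adjoint_form_def bilinear_form_def)
  ultimately show "f \<in> Hom"
    using f by (auto simp: lmodule_hom_def dual_module_def linear_on_def fun_eq_iff)
qed

lemma restrict_form_Hom:
  assumes "adjoint_form S M b"
  shows "restrict_form M b \<in> Hom"
  using assms act_closed carrier_add carrier_smult
  unfolding Hom_iff
  by (auto simp: adjoint_form_def bilinear_form_def linear_on_def restrict_form_def restrict0_def)

lemma pivot_inverse:
  obtains g' where "g * g' = 1" "g' * g = 1" "S g = g'" "\<And>a. S (S a) = g * a * g'"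
  using P.pivot by blast

section \<open>The involution on adjoint forms given by the pivot\<close>

definition pivot_swap :: "('v \<Rightarrow> 'v \<Rightarrow> 'k) \<Rightarrow> 'v \<Rightarrow> 'v \<Rightarrow> 'k" where
  "pivot_swap b = (\<lambda>v w. b w (act M g v))"

text \<open>Evaluating the composite at \<open>v\<close> and \<open>w\<close> pairs
  \<open>j(v)\<close> with \<open>f(w)\<close>, which is \<open>f(w)(gv)\<close>. Thus
  \<open>pivot_swap\<close> is, up to truncation, the operator whose trace is the indicator.\<close>

lemma transpose_pivot:
  assumes "f \<in> Hom"
  shows "transpose_map M (dual_module S M) f \<circ> pivot_map g M = restrict_form M (pivot_swap f)"
proof -
  have "(transpose_map M (dual_module S M) f \<circ> pivot_map g M) v = restrict_form M (pivot_swap f) v" for v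
  proof -
    \<comment> \<open>Needed because \<open>transpose_map\<close> is set to 0 outside the dual of
      the dual module.\<close>
    have D: "pivot_map g M v \<in> dual_space (dual_module S M)"
      by (auto simp: pivot_map_def dual_space_def[of "dual_module S M"] linear_on_def
          restrict0_def dual_module_def fun_smult_def)
        (auto simp: dual_space_def linear_on_def fun_smult_def distrib_left)
    have "f w \<in> dual_space M" if "w \<in> C" for w
      using assms that by (auto simp: lmodule_hom_def dual_module_def)
    then show ?thesis
      using D by (auto simp: transpose_map_def pivot_map_def restrict_form_def restrict0_def
          pivot_swap_def fun_eq_iff)
  qed
  then show ?thesis by (simp add: fun_eq_iff)
qed

text \<open>From \<open>S (S a) * g = g * a\<close> one gets
  \<open>b(w, gav) = b(w, S(S(a))gv) = b(S(a)w, gv)\<close>.\<close>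

lemma pivot_swap_adjoint:
  assumes "adjoint_form S M b"
  shows "adjoint_form S M (pivot_swap b)"
proof -
  obtain g' where g': "g' * g = 1" "\<And>a. S (S a) = g * a * g'" using pivot_inverse by metis
  have "b w (act M g (act M a v)) = b (act M (S a) w) (act M g v)" if "v \<in> C" "w \<in> C" for a v w
  proof -
    have "S (S a) * g = g * a" by (simp add: g' mult.assoc)
    then show ?thesis
      using assms that by (simp add: adjoint_form_def act_closed flip: act_mult)
  qed
  then show ?thesis
    using assms act_closed
    by (auto simp: adjoint_form_def bilinear_form_def linear_on_def pivot_swap_def
        act_add_right act_smult_right)
qed

text \<open>Swapping twice gives \<open>b(gv, gw) = b(v, S(g)gw)\<close>, and \<open>S(g)\<close> is
  the inverse of \<open>g\<close>.\<close>

lemma pivot_swap_twice: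
  assumes "adjoint_form S M b" "v \<in> C" "w \<in> C"
  shows "pivot_swap (pivot_swap b) v w = b v w"
proof -
  obtain g' where g': "g' * g = 1" "S g = g'" using pivot_inverse by metis
  have "b (act M g v) (act M g w) = b v (act M (S g) (act M g w))"
    using assms by (simp add: adjoint_form_def act_closed)
  also have "\<dots> = b v w" using assms g' by (simp add: act_one flip: act_mult)
  finally show ?thesis by (simp add: pivot_swap_def)
qed

text \<open>The radicals on both sides are submodules; on the right this uses that \<open>S\<close> is surjective,
  because \<open>S\<^sup>2\<close> is conjugation by the pivot.\<close>
lemma simple_adjoint_form_nondegenerate:
  assumes simple: "simple_module M" and b: "adjoint_form S M b"
    and nz: "v0 \<in> C" "w0 \<in> C" "b v0 w0 \<noteq> 0"
  shows "nondegenerate M b"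
proof -
  obtain g' where g': "g * g' = 1" "\<And>a. S (S a) = g * a * g'" using pivot_inverse by metis
  have addl: "b (v + w) x = b v x + b w x" and scalel: "b (smult M c v) x = c * b v x"
    and addr: "b x (v + w) = b x v + b x w" and scaler: "b x (smult M c v) = c * b x v"
    and adj: "b (act M a v) x = b v (act M (S a) x)"
    if "v \<in> C" "w \<in> C" "x \<in> C" for a c v w x
    using b that by (auto simp: adjoint_form_def bilinear_form_def linear_on_def)
  \<comment> \<open>The element \<open>S (g' * a * g)\<close> is an explicit preimage of
    \<open>a\<close> under \<open>S\<close>, so the action can be moved from the right argument to
    the left.\<close>
  have adj': "b v (act M a x) = b (act M (S (g' * a * g)) v) x" if "v \<in> C" "x \<in> C" for a v x
  proof -
    have "g * (g' * a * g) * g' = (g * g') * a * (g * g')" by (simp only: mult.assoc)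
    then have "S (S (g' * a * g)) = a" by (simp add: g')
    then show ?thesis using adj[OF that(1) that(1) that(2)] by simp
  qed
  have zero: "b 0 x = 0 \<and> b x 0 = 0" if "x \<in> C" for x
    using scalel[OF carrier_0 carrier_0 that, of 0] scaler[OF carrier_0 carrier_0 that, of 0] by simp
  have "(\<forall>v\<in>C. (\<forall>w\<in>C. b v w = 0) \<longrightarrow> v = 0) \<or> (\<forall>v\<in>C. \<forall>w\<in>C. b v w = 0)"
    by (rule simple_submodule_cases[OF simple])
      (auto simp: zero addl scalel adj act_closed)
  moreover have "(\<forall>w\<in>C. (\<forall>v\<in>C. b v w = 0) \<longrightarrow> w = 0) \<or> (\<forall>w\<in>C. \<forall>v\<in>C. b v w = 0)"
    by (rule simple_submodule_cases[OF simple])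
      (auto simp: zero addr scaler adj' act_closed)
  ultimately show ?thesis using nz unfolding nondegenerate_def by blast
qed

section \<open>Non-zero homomorphisms are bijective, and they span a line\<close>

lemma Hom_nonzero_nondegenerate:
  assumes "simple_module M" "f \<in> Hom" "f \<noteq> 0"
  shows "nondegenerate M f"
proof -
  obtain v w where "f v w \<noteq> 0" using assms(3) by (auto simp: fun_eq_iff)
  then show ?thesis
    using assms(1,2) simple_adjoint_form_nondegenerate[of f v w] unfolding Hom_iff by blast
qed

text \<open>The kernel of \<open>f\<close> is the left radical of the form, which is trivial;
  surjectivity then follows by counting dimensions.\<close>

lemma nondegenerate_Hom_bij:
  assumes fin: "finite_dim M" and f: "f \<in> Hom" and nd: "nondegenerate M f"
  shows "bij_betw f C (dual_space M)"
proof -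
  have lin: "linear_on C (smult M) (fun_smult (*)) f" and img: "f ` C \<subseteq> dual_space M"
    using f by (auto simp: lmodule_hom_def dual_module_def)
  have inj: "inj_on f C"
  proof (rule inj_onI)
    fix v w assume vw: "v \<in> C" "w \<in> C" "f v = f w"
    have neg: "smult M (- 1) w \<in> C" using carrier_smult[OF vw(2)] .
    have "f (v + smult M (- 1) w) = f v + f (smult M (- 1) w)"
      using lin vw(1) neg unfolding linear_on_def by blast
    also have "f (smult M (- 1) w) = fun_smult (*) (- 1) (f w)"
      using lin vw(2) unfolding linear_on_def by blast
    finally have "f (v + smult M (- 1) w) = f v + fun_smult (*) (- 1) (f w)" .
    then have "f (v + smult M (- 1) w) x = 0" for x
      by (simp add: vw(3) fun_smult_def)
    then have "v + smult M (- 1) w = 0"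
      using nd carrier_add[OF vw(1) neg] unfolding nondegenerate_def by blast
    then show "v = w" by simp
  qed
  show ?thesis
    using linear_on_dual_inj_imp_surj[OF fin lin img inj] inj by (simp add: bij_betw_def)
qed

text \<open>Since \<open>f\<close> is bijective onto the dual, \<open>f'\<close> followed by the
  inverse of \<open>f\<close> is an endomorphism of \<open>M\<close>, hence a scalar by absolute
  simplicity.\<close>

lemma Hom_one_dimensional:
  assumes fin: "finite_dim M" and abs: "absolutely_simple M"
    and f: "f \<in> Hom" "f \<noteq> 0" and f': "f' \<in> Hom"
  obtains c where "f' = fun_smult (fun_smult (*)) c f"
proof -
  have simple: "simple_module M" using abs by (simp add: absolutely_simple_def)
  have bij: "bij_betw f C (dual_space M)"
    using nondegenerate_Hom_bij[OF fin f(1) Hom_nonzero_nondegenerate[OF simple f]] .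
  then have inj: "inj_on f C" by (simp add: bij_betw_def)
  define h where "h = restrict0 C (\<lambda>v. inv_into C f (f' v))"
  have "f' v \<in> f ` C" if "v \<in> C" for v
    using f' that bij by (auto simp: lmodule_hom_def dual_module_def bij_betw_def)
  then have h: "h v \<in> C" "f (h v) = f' v" if "v \<in> C" for v
    using that by (auto simp: h_def restrict0_def inv_into_into f_inv_into_f)
  have homD: "F (v + w) = F v + F w" "F (smult M c v) = fun_smult (*) c (F v)"
      "F (act M a v) = act (dual_module S M) a (F v)"
    if "F \<in> Hom" "v \<in> C" "w \<in> C" for F v w c a
    using that by (auto simp: lmodule_hom_def linear_on_def dual_module_def)
  have "h \<in> lmodule_hom M M"
    unfolding lmodule_hom_def linear_on_def mem_Collect_eq
  proof (intro conjI allI ballI impI)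
    show "h ` C \<subseteq> C" using h by blast
    \<comment> \<open>This and the next two identities are checked after applying \<open>f\<close>,
      which is injective on \<open>C\<close> and turns \<open>h\<close> into
      \<open>f'\<close>.\<close>
    show "h (v + w) = h v + h w" if "v \<in> C" "w \<in> C" for v w
      by (rule inj_onD[OF inj]) (use that h homD f(1) f' carrier_add in simp_all)
    show "h (smult M c v) = smult M c (h v)" if "v \<in> C" for c v
      by (rule inj_onD[OF inj]) (use that h homD f(1) f' carrier_smult in simp_all)
    show "h (act M a v) = act M a (h v)" if "v \<in> C" for a v
      by (rule inj_onD[OF inj]) (use that h homD f(1) f' act_closed in simp_all)
    show "h v = 0" if "v \<notin> C" for v using that by (simp add: h_def restrict0_def)
  qed
  then obtain c where c: "\<And>v. v \<in> C \<Longrightarrow> h v = smult M c v"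
    using absolutely_simple_endomorphism[OF abs] by blast
  have "f' v = fun_smult (*) c (f v)" for v
  proof (cases "v \<in> C")
    case True
    then show ?thesis using h(2)[OF True] c[OF True] homD(2)[OF f(1) True True] by simp
  next
    case False
    then show ?thesis using f(1) f' by (auto simp: lmodule_hom_def fun_smult_def fun_eq_iff)
  qed
  then have "f' = fun_smult (fun_smult (*)) c f"
    unfolding fun_smult_def[of "fun_smult (*)"] by blast
  then show ?thesis by (rule that)
qed

section \<open>The value of the indicator\<close>

lemma fs_indicator_Hom_zero:
  assumes "Hom \<subseteq> {0}"
  shows "fs_indicator S g M = 0"
proof -
  interpret H: vector_space "fun_smult (fun_smult (*)) :: 'k \<Rightarrow> ('v \<Rightarrow> 'v \<Rightarrow> 'k) \<Rightarrow> 'v \<Rightarrow> 'v \<Rightarrow> 'k"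
    by (intro vector_space_fun_smult vector_space_times)
  have "0 \<in> Hom"
    by (simp add: Hom_iff adjoint_form_def bilinear_form_def linear_on_def)
  with assms have "Hom = {0}" by blast
  then have span: "H.span {} = Hom" using H.span_empty by simp
  have T: "transpose_map M (dual_module S M) f \<circ> pivot_map g M = fun_smult (fun_smult (*)) 0 f"
    if "f \<in> H.span {}" for f
  proof -
    have f: "f \<in> Hom" "f = 0" using that \<open>Hom = {0}\<close> span by auto
    show ?thesis
      unfolding transpose_pivot[OF f(1)] unfolding f(2)
      by (simp add: restrict_form_def restrict0_def pivot_swap_def fun_eq_iff fun_smult_def)
  qed
  \<comment> \<open>The zero space has the empty basis, so the trace is an empty sum.\<close>
  have "trace_on (fun_smult (fun_smult (*))) (H.span {})
      (\<lambda>f. transpose_map M (dual_module S M) f \<circ> pivot_map g M) = of_nat (card ({} :: ('v \<Rightarrow> 'v \<Rightarrow> 'k) set)) * 0"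
    by (intro H.trace_on_scalar H.independent_empty finite.emptyI T)
  then show ?thesis unfolding fs_indicator_def span by simp
qed

text \<open>The operator acts on the line spanned by \<open>f\<close> through a scalar
  \<open>c\<close>. Being an involution, it forces \<open>c * c = 1\<close>, and its trace on a line
  is \<open>c\<close> itself.\<close>

lemma fs_indicator_Hom_nonzero:
  assumes fin: "finite_dim M" and abs: "absolutely_simple M" and f: "f \<in> Hom" "f \<noteq> 0"
  shows "fs_indicator S g M \<in> {1, -1}"
    and "\<And>v w. v \<in> C \<Longrightarrow> w \<in> C \<Longrightarrow> f w (act M g v) = fs_indicator S g M * f v w"
proof -
  interpret H: vector_space "fun_smult (fun_smult (*)) :: 'k \<Rightarrow> ('v \<Rightarrow> 'v \<Rightarrow> 'k) \<Rightarrow> 'v \<Rightarrow> 'v \<Rightarrow> 'k"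
    by (intro vector_space_fun_smult vector_space_times)
  have adj: "adjoint_form S M f" using f by (simp add: Hom_iff)
  have "restrict_form M (pivot_swap f) \<in> Hom"
    by (intro restrict_form_Hom pivot_swap_adjoint adj)
  then obtain c where "restrict_form M (pivot_swap f) = fun_smult (fun_smult (*)) c f"
    using Hom_one_dimensional[OF fin abs f] by blast
  then have swap: "f w (act M g v) = c * f v w" if "v \<in> C" "w \<in> C" for v w
    using restrict_form_apply[OF that, of "pivot_swap f"]
    by (simp add: pivot_swap_def fun_smult_def)
  obtain v w where nz: "f v w \<noteq> 0" using f(2) by (auto simp: fun_eq_iff)
  then have vw: "v \<in> C" "w \<in> C" using f(1) unfolding Hom_iff by blast+
  \<comment> \<open>The eigenvalue equation \<open>swap\<close> is used twice, first for the pair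
    \<open>w\<close>, \<open>gv\<close> and then for \<open>v\<close>, \<open>w\<close>.\<close>
  have "f v w = f (act M g v) (act M g w)"
    using pivot_swap_twice[OF adj vw] by (simp add: pivot_swap_def)
  also have "\<dots> = c * f w (act M g v)" using swap vw act_closed by blast
  also have "\<dots> = c * c * f v w" using swap vw by simp
  finally have "c * c = 1" using nz by simp
  then have c: "c \<in> {1, -1}" by (simp add: square_eq_1_iff)
  have scaled: "fun_smult (fun_smult (*)) k f \<in> Hom" for k
    using f(1) unfolding Hom_iff
    by (auto simp: adjoint_form_def bilinear_form_def linear_on_def fun_smult_def algebra_simps)
  have span: "H.span {f} = Hom"
    unfolding H.span_singleton
  proof
    show "range (\<lambda>k. fun_smult (fun_smult (*)) k f) \<subseteq> Hom" using scaled by blast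
    show "Hom \<subseteq> range (\<lambda>k. fun_smult (fun_smult (*)) k f)"
    proof
      fix F assume "F \<in> Hom"
      then obtain k where "F = fun_smult (fun_smult (*)) k f"
        using Hom_one_dimensional[OF fin abs f] by blast
      then show "F \<in> range (\<lambda>k. fun_smult (fun_smult (*)) k f)" by (rule range_eqI)
    qed
  qed
  have T: "transpose_map M (dual_module S M) F \<circ> pivot_map g M = fun_smult (fun_smult (*)) c F"
    if F: "F \<in> Hom" for F
  proof -
    obtain k where k: "F = fun_smult (fun_smult (*)) k f"
      using Hom_one_dimensional[OF fin abs f F] by blast
    have "restrict_form M (pivot_swap F) v w = c * F v w" for v w
    proof (cases "v \<in> C \<and> w \<in> C")
      case True
      then show ?thesis
        using swap[of v w] by (simp add: restrict_form_apply pivot_swap_def k fun_smult_def)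
    next
      case False
      then show ?thesis
        using F unfolding Hom_iff by (auto simp: restrict_form_def restrict0_def)
    qed
    then show ?thesis
      unfolding transpose_pivot[OF F] by (simp add: fun_smult_def fun_eq_iff)
  qed
  have "trace_on (fun_smult (fun_smult (*))) (H.span {f})
      (\<lambda>f. transpose_map M (dual_module S M) f \<circ> pivot_map g M) = of_nat (card {f}) * c"
    by (rule H.trace_on_scalar) (use f(2) T span in simp_all)
  then have "fs_indicator S g M = c" unfolding fs_indicator_def span by simp
  then show "fs_indicator S g M \<in> {1, -1}"
    and "\<And>v w. v \<in> C \<Longrightarrow> w \<in> C \<Longrightarrow> f w (act M g v) = fs_indicator S g M * f v w"
    using c swap by auto
qed

section \<open>The equivalent conditions, and uniqueness of the form\<close>

text \<open>The existence of a non-zero homomorphism is the hub to which all three conditions are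
  compared. An isomorphism is non-zero because \<open>C\<close> is not \<open>{0}\<close>;
  conversely, non-zero homomorphisms are bijective.\<close>

lemma simple_iso_dual_iff:
  assumes fin: "finite_dim M" and simple: "simple_module M"
  shows "lmodule_iso M (dual_module S M) \<longleftrightarrow> \<not> Hom \<subseteq> {0}"
proof
  assume "lmodule_iso M (dual_module S M)"
  then obtain f where f: "f \<in> Hom" "inj_on f C" by (auto simp: lmodule_iso_def bij_betw_def)
  have "f \<noteq> 0"
  proof
    assume "f = 0"
    then have "C = {0}" using f(2) carrier_0 by (auto simp: inj_on_def)
    then show False using simple by (simp add: simple_module_def)
  qed
  then show "\<not> Hom \<subseteq> {0}" using f(1) by blast
next
  assume "\<not> Hom \<subseteq> {0}"
  then obtain f where f: "f \<in> Hom" "f \<noteq> 0" by blast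
  have "bij_betw f C (dual_space M)"
    using nondegenerate_Hom_bij[OF fin f(1) Hom_nonzero_nondegenerate[OF simple f]] .
  then show "lmodule_iso M (dual_module S M)"
    using f(1) by (auto simp: lmodule_iso_def dual_module_def)
qed

text \<open>Brings an arbitrary form under the results on \<open>Hom\<close>. The truncation is
  non-zero because some non-zero \<open>v\<close> in \<open>C\<close> pairs non-trivially with some
  \<open>w\<close> in \<open>C\<close>.\<close>

lemma nondeg_adjoint_form_restrict:
  assumes simple: "simple_module M" and b: "nondeg_adjoint_form S M b"
  shows "restrict_form M b \<in> Hom" "restrict_form M b \<noteq> 0"
proof -
  show "restrict_form M b \<in> Hom"
    using restrict_form_Hom b by (simp add: nondeg_adjoint_form_iff)
  obtain v where v: "v \<in> C" "v \<noteq> 0"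
    using simple carrier_0 unfolding simple_module_def by blast
  then obtain w where w: "w \<in> C" "b v w \<noteq> 0"
    using b unfolding nondeg_adjoint_form_def nondegenerate_def by blast
  then show "restrict_form M b \<noteq> 0"
    using restrict_form_apply[OF v(1) w(1), of b] by (metis zero_fun_apply)
qed

lemma simple_nondeg_adjoint_form_iff:
  assumes simple: "simple_module M"
  shows "(\<exists>b. nondeg_adjoint_form S M b) \<longleftrightarrow> \<not> Hom \<subseteq> {0}"
proof
  assume "\<exists>b. nondeg_adjoint_form S M b"
  then show "\<not> Hom \<subseteq> {0}" using nondeg_adjoint_form_restrict[OF simple] by blast
next
  assume "\<not> Hom \<subseteq> {0}"
  then obtain f where f: "f \<in> Hom" "f \<noteq> 0" by blast
  then have "nondeg_adjoint_form S M f"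
    using Hom_nonzero_nondegenerate[OF simple f] by (simp add: nondeg_adjoint_form_iff Hom_iff)
  then show "\<exists>b. nondeg_adjoint_form S M b" by blast
qed

text \<open>Both truncations are non-zero vectors of the same line, which also makes the factor
  non-zero.\<close>

lemma nondeg_adjoint_form_unique:
  assumes fin: "finite_dim M" and abs: "absolutely_simple M"
    and b: "nondeg_adjoint_form S M b" and b': "nondeg_adjoint_form S M b'"
  shows "\<exists>c. c \<noteq> 0 \<and> (\<forall>v\<in>C. \<forall>w\<in>C. b' v w = c * b v w)"
proof -
  have simple: "simple_module M" using abs by (simp add: absolutely_simple_def)
  note B = nondeg_adjoint_form_restrict[OF simple b] and B' = nondeg_adjoint_form_restrict[OF simple b']
  obtain c where c: "restrict_form M b' = fun_smult (fun_smult (*)) c (restrict_form M b)"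
    using Hom_one_dimensional[OF fin abs B B'(1)] .
  have "c \<noteq> 0" using c B'(2) by (auto simp: fun_smult_def fun_eq_iff)
  moreover have "b' v w = c * b v w" if "v \<in> C" "w \<in> C" for v w
    using restrict_form_apply[OF that, of b] restrict_form_apply[OF that, of b']
    by (simp add: c fun_smult_def)
  ultimately show ?thesis by blast
qed

lemma nondeg_adjoint_form_pivot:
  assumes fin: "finite_dim M" and abs: "absolutely_simple M"
    and b: "nondeg_adjoint_form S M b" and vw: "v \<in> C" "w \<in> C"
  shows "b w (act M g v) = fs_indicator S g M * b v w"
proof -
  have simple: "simple_module M" using abs by (simp add: absolutely_simple_def)
  \<comment> \<open>Since \<open>gv\<close> stays in the carrier, truncation changes neither side of
    the identity.\<close>
  show ?thesis
    using fs_indicator_Hom_nonzero(2)[OF fin abs nondeg_adjoint_form_restrict[OF simple b] vw]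
      restrict_form_apply[OF vw, of b] restrict_form_apply[OF vw(2) act_closed[OF vw(1)], of b]
    by simp
qed

end

theorem theorem3p4:
  fixes scaleA :: "'k::field \<Rightarrow> 'a::{ring, monoid_mult} \<Rightarrow> 'a"
    and S :: "'a \<Rightarrow> 'a" and g :: 'a
    and V :: "('k, 'a, 'v::ab_group_add) lmodule"
  assumes "(2::'k) \<noteq> 0"
    and "pivotal_algebra scaleA S g"
    and "left_module scaleA V"
    and "finite_dim V"
    and "absolutely_simple V"
  shows "fs_indicator S g V \<in> {0, 1, -1} \<and>
    (fs_indicator S g V \<noteq> 0 \<longleftrightarrow> lmodule_iso V (dual_module S V)) \<and>
    (lmodule_iso V (dual_module S V) \<longleftrightarrow> (\<exists>b. nondeg_adjoint_form S V b)) \<and>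
    (fs_indicator S g V \<noteq> 0 \<or> lmodule_iso V (dual_module S V) \<or> (\<exists>b. nondeg_adjoint_form S V b) \<longrightarrow>
      (\<forall>b b'. nondeg_adjoint_form S V b \<and> nondeg_adjoint_form S V b' \<longrightarrow>
        (\<exists>c. c \<noteq> 0 \<and> (\<forall>v\<in>carrier V. \<forall>w\<in>carrier V. b' v w = c * b v w))) \<and>
      (\<forall>b. nondeg_adjoint_form S V b \<longrightarrow>
        (\<forall>v\<in>carrier V. \<forall>w\<in>carrier V. b w (act V g v) = fs_indicator S g V * b v w)))"
proof -
  interpret pivotal_module scaleA S g V
    using assms(2,3) by (rule pivotal_module.intro)
  have simple: "simple_module V" using assms(5) by (simp add: absolutely_simple_def)
  have ind: "fs_indicator S g V \<in> {0, 1, -1} \<and> (fs_indicator S g V \<noteq> 0 \<longleftrightarrow> \<not> Hom \<subseteq> {0})"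
  proof (cases "Hom \<subseteq> {0}")
    case True
    then show ?thesis using fs_indicator_Hom_zero by simp
  next
    case False
    then obtain f where "f \<in> Hom" "f \<noteq> 0" by blast
    then have "fs_indicator S g V \<in> {1, -1}" by (rule fs_indicator_Hom_nonzero(1)[OF assms(4,5)])
    then show ?thesis using False by auto
  qed
  show ?thesis
    \<comment> \<open>Conditions (2) and (3) both become the existence of a non-zero homomorphism,
      so the first equivalence is part of \<open>ind\<close> and the second is trivial.\<close>
    unfolding simple_iso_dual_iff[OF assms(4) simple] simple_nondeg_adjoint_form_iff[OF simple]
    by (intro conjI impI allI ballI conjunct1[OF ind] conjunct2[OF ind] refl)
      (simp_all add: nondeg_adjoint_form_unique[OF assms(4,5)] nondeg_adjoint_form_pivot[OF assms(4,5)])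
qed

end
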